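(* The one-dimensional subalgebras of ${\rm A}_4$ are exactly $\langle e_1\rangle$, $\langle e_2\rangle$, $\langle e_1-e_2\rangle$, $\langle e_1+e_2\pm \mathrm{i}e_3\rangle$ and $\langle e_1-e_2\pm\mathrm{i}e_3\rangle$. Up to automorphisms of ${\rm A}_4$, every one-dimensional subalgebra is equivalent to one of $\langle e_1\rangle$, $\langle e_2\rangle$, $\langle e_1-e_2\rangle$, $\langle e_1+e_2+\mathrm{i}e_3\rangle$, $\langle e_1-e_2+\mathrm{i}e_3\rangle$.
   Context: ${\rm A}_4$ is the complex algebra with basis $e_1,e_2,e_3$, unit $e_1$ ($e_1e_i=e_ie_1=e_i$), $e_2e_2=e_2$ and $e_3e_3=-e_1+e_2$; all other products of basis elements are zero. $\mathrm{i}=\sqrt{-1}$. A subalgebra is a linear subspace closed under multiplication (it need not contain $e_1$). Equivalence up to automorphisms means one is mapped onto the other by an algebra automorphism. $\langle S\rangle$ denotes linear span. *)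

theory Defs
  imports "HOL-Analysis.Analysis"
begin

text \<open>The algebra A_4: underlying complex vector space complex^3 with basis
  e1 = axis 1 1, e2 = axis 2 1, e3 = axis 3 1 (complex scalar multiplication (*s)).\<close>

type_synonym A4 = "complex ^ 3"

definition e1 :: A4 where "e1 = axis 1 1"
definition e2 :: A4 where "e2 = axis 2 1"
definition e3 :: A4 where "e3 = axis 3 1"

text \<open>Product: (a1 e1 + a2 e2 + a3 e3)(b1 e1 + b2 e2 + b3 e3), using e1 unit,
  e2 e2 = e2, e3 e3 = -e1 + e2, all other products of basis elements zero.\<close>
definition A4_mult :: "A4 \<Rightarrow> A4 \<Rightarrow> A4" where
  "A4_mult x y =
     (x$1 * y$1) *s e1
   + (x$1 * y$2 + x$2 * y$1 + x$2 * y$2) *s e2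
   + (x$1 * y$3 + x$3 * y$1) *s e3
   + (x$3 * y$3) *s (e2 - e1)"

text \<open>Subalgebra: complex linear subspace closed under multiplication.\<close>
definition A4_subalgebra :: "A4 set \<Rightarrow> bool" where
  "A4_subalgebra S \<longleftrightarrow> vec.subspace S \<and> (\<forall>x\<in>S. \<forall>y\<in>S. A4_mult x y \<in> S)"

text \<open>Algebra automorphism: bijective complex-linear multiplicative map.\<close>
definition A4_automorphism :: "(A4 \<Rightarrow> A4) \<Rightarrow> bool" where
  "A4_automorphism f \<longleftrightarrow> Vector_Spaces.linear (*s) (*s) f \<and> bij f
     \<and> (\<forall>x y. f (A4_mult x y) = A4_mult (f x) (f y))"

end

theory Submission imports Defs begin

(* A line \<langle>v\<rangle> is a subalgebra iff v\<^sup>2 = \<lambda>v.  For v = a e1 + b e2 + c e3 this reads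
   a\<^sup>2 - c\<^sup>2 = \<lambda>a, 2ab + b\<^sup>2 + c\<^sup>2 = \<lambda>b, 2ac = \<lambda>c.  If c = 0, the line is \<langle>e1\<rangle>, \<langle>e2\<rangle> or
   \<langle>e1 - e2\<rangle>; if c \<noteq> 0, then \<lambda> = 2a, so c = \<plusminus>ia and b = \<plusminus>a.  The automorphism e3 \<mapsto> -e3
   exchanges the lines through e1 \<plusminus> e2 - ie3 and e1 \<plusminus> e2 + ie3. *)

lemma (in vector_space) dim_eq_1_obtains_span_singleton:
  assumes "subspace S" "dim S = 1"
  obtains v where "v \<noteq> 0" "S = span {v}"
proof -
  obtain B where B: "B \<subseteq> S" "independent B" "S \<subseteq> span B" "card B = 1"
    using basis_exists[of S] assms(2) by metis
  then obtain v where "B = {v}"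
    by (meson card_1_singletonE)
  with B assms(1) have "v \<noteq> 0" "S = span {v}"
    using dependent_zero span_minimal by blast+
  then show thesis ..
qed

lemma (in finite_dimensional_vector_space) dim_span_singleton:
  "v \<noteq> 0 \<Longrightarrow> dim (span {v}) = 1"
  using dim_insert[of v "{}"] by simp

lemma (in vector_space) span_singleton_scale:
  "scale c v \<noteq> 0 \<Longrightarrow> span {scale c v} = span {v}"
  using span_image_scale[of "{v}" "\<lambda>_. c"] by auto

lemma A4_eq_iff: "(x::A4) = y \<longleftrightarrow> x$1 = y$1 \<and> x$2 = y$2 \<and> x$3 = y$3"
  by (simp add: vec_eq_iff forall_3)

lemma e1_nth [simp]: "e1$1 = 1" "e1$2 = 0" "e1$3 = 0"
  and e2_nth [simp]: "e2$1 = 0" "e2$2 = 1" "e2$3 = 0"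
  and e3_nth [simp]: "e3$1 = 0" "e3$2 = 0" "e3$3 = 1"
  by (simp_all add: e1_def e2_def e3_def axis_def)

lemma A4_mult_nth [simp]:
  "A4_mult x y $ 1 = x$1 * y$1 - x$3 * y$3"
  "A4_mult x y $ 2 = x$1 * y$2 + x$2 * y$1 + x$2 * y$2 + x$3 * y$3"
  "A4_mult x y $ 3 = x$1 * y$3 + x$3 * y$1"
  by (simp_all add: A4_mult_def)

lemma A4_mult_scale: "A4_mult (s *s x) (t *s y) = (s * t) *s A4_mult x y"
  unfolding A4_eq_iff by (simp add: algebra_simps)

lemma A4_subalgebra_span_singleton_iff:
  "A4_subalgebra (vec.span {v}) \<longleftrightarrow> A4_mult v v \<in> vec.span {v}"
proof
  assume "A4_mult v v \<in> vec.span {v}"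
  then have "A4_mult x y \<in> vec.span {v}" if "x \<in> vec.span {v}" "y \<in> vec.span {v}" for x y
    using that by (auto simp: vec.span_singleton A4_mult_scale)
  then show "A4_subalgebra (vec.span {v})"
    unfolding A4_subalgebra_def by simp
qed (simp add: A4_subalgebra_def vec.span_base)

lemma square_eq_scale_solutions:
  fixes a b c l :: complex
  assumes h1: "a*a - c*c = l*a" and h2: "a*b + b*a + b*b + c*c = l*b" and h3: "a*c + c*a = l*c"
  shows "a = 0 \<and> c = 0 \<or> b = 0 \<and> c = 0 \<or> b = -a \<and> c = 0
    \<or> (b = a \<or> b = -a) \<and> (c = \<i>*a \<or> c = -\<i>*a)"
proof (cases "c = 0")
  case True
  show ?thesis
  proof (cases "a = 0")
    case False
    with h1 \<open>c = 0\<close> have "l = a" by simp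
    with h2 \<open>c = 0\<close> have "b * (b + a) = 0" by (simp add: algebra_simps)
    with \<open>c = 0\<close> show ?thesis by (auto simp: add_eq_0_iff2)
  qed (simp add: \<open>c = 0\<close>)
next
  case False
  with h3 have l: "l = 2*a" by (simp add: algebra_simps)
  with h1 have a2: "c*c + a*a = 0"
    by (simp add: algebra_simps)
  have "(c - \<i>*a) * (c + \<i>*a) = c*c + a*a"
    by (simp add: algebra_simps power2_eq_square[symmetric])
  with a2 have c: "c = \<i>*a \<or> c = -\<i>*a" by (auto simp: add_eq_0_iff2)
  from h2 l have b2: "c*c + b*b = 0"
    by (simp add: algebra_simps)
  have "(b - a) * (b + a) = (c*c + b*b) - (c*c + a*a)"
    by (simp add: algebra_simps)
  with a2 b2 have "(b - a) * (b + a) = 0" by simp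
  then have "b = a \<or> b = -a" by (auto simp: add_eq_0_iff2)
  with c show ?thesis by blast
qed

definition A4_line_generators :: "A4 set" where
  "A4_line_generators = {e1, e2, e1 - e2, e1 + e2 + \<i> *s e3, e1 + e2 - \<i> *s e3,
     e1 - e2 + \<i> *s e3, e1 - e2 - \<i> *s e3}"

lemma A4_square_eq_scale_imp_multiple_of_generator:
  assumes "A4_mult v v = l *s v"
  obtains k w where "w \<in> A4_line_generators" "v = k *s w"
proof -
  define a b c where "a = v$1" and "b = v$2" and "c = v$3"
  have "a*a - c*c = l*a" "a*b + b*a + b*b + c*c = l*b" "a*c + c*a = l*c"
    using assms unfolding A4_eq_iff by (simp_all add: a_def b_def c_def)
  then have "a = 0 \<and> c = 0 \<or> b = 0 \<and> c = 0 \<or> b = -a \<and> c = 0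
    \<or> (b = a \<or> b = -a) \<and> (c = \<i>*a \<or> c = -\<i>*a)"
    by (rule square_eq_scale_solutions)
  then have "v = b *s e2 \<or> v \<in> (\<lambda>w. a *s w) ` A4_line_generators"
    unfolding A4_line_generators_def by (auto simp: A4_eq_iff a_def b_def c_def)
  then show thesis
    using that unfolding A4_line_generators_def by blast
qed

lemma A4_line_generators_square:
  "w \<in> A4_line_generators \<Longrightarrow> A4_mult w w = w \<or> A4_mult w w = 2 *s w"
  unfolding A4_line_generators_def by (auto simp: A4_eq_iff algebra_simps)

lemma A4_line_generators_nonzero: "w \<in> A4_line_generators \<Longrightarrow> w \<noteq> 0"
  unfolding A4_line_generators_def by (auto simp: A4_eq_iff)

lemma A4_one_dim_subalgebra_iff:
  "A4_subalgebra S \<and> vec.dim S = 1 \<longleftrightarrow> S \<in> (\<lambda>w. vec.span {w}) ` A4_line_generators"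
proof
  assume S: "A4_subalgebra S \<and> vec.dim S = 1"
  then obtain v where v: "v \<noteq> 0" "S = vec.span {v}"
    using vec.dim_eq_1_obtains_span_singleton unfolding A4_subalgebra_def by blast
  with S have "A4_mult v v \<in> vec.span {v}"
    using A4_subalgebra_span_singleton_iff by blast
  then obtain l where "A4_mult v v = l *s v"
    by (auto simp: vec.span_singleton)
  then obtain k w where "w \<in> A4_line_generators" "v = k *s w"
    by (rule A4_square_eq_scale_imp_multiple_of_generator)
  with v show "S \<in> (\<lambda>w. vec.span {w}) ` A4_line_generators"
    using vec.span_singleton_scale by blast
next
  assume "S \<in> (\<lambda>w. vec.span {w}) ` A4_line_generators"
  then obtain w where w: "w \<in> A4_line_generators" "S = vec.span {w}" by blast
  then have "A4_mult w w \<in> vec.span {w}"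
    using A4_line_generators_square vec.span_base vec.span_scale by fastforce
  with w show "A4_subalgebra S \<and> vec.dim S = 1"
    by (simp add: A4_subalgebra_span_singleton_iff vec.dim_span_singleton
        A4_line_generators_nonzero)
qed

definition A4_negate_e3 :: "A4 \<Rightarrow> A4" where
  "A4_negate_e3 x = (\<chi> i. if i = 3 then - x$i else x$i)"

lemma A4_negate_e3_nth [simp]:
  "A4_negate_e3 x $ 1 = x$1" "A4_negate_e3 x $ 2 = x$2" "A4_negate_e3 x $ 3 = - x$3"
  by (simp_all add: A4_negate_e3_def)

lemma A4_automorphism_negate_e3: "A4_automorphism A4_negate_e3"
proof -
  have "Vector_Spaces.linear (*s) (*s) A4_negate_e3"
    unfolding A4_negate_e3_def by unfold_locales (vector algebra_simps)+
  moreover have "A4_negate_e3 \<circ> A4_negate_e3 = id"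
    by (simp add: fun_eq_iff A4_eq_iff)
  then have "bij A4_negate_e3"
    using o_bij by blast
  moreover have "A4_negate_e3 (A4_mult x y) = A4_mult (A4_negate_e3 x) (A4_negate_e3 y)" for x y
    by (simp add: A4_eq_iff)
  ultimately show ?thesis
    unfolding A4_automorphism_def by blast
qed

lemma A4_automorphism_id: "A4_automorphism id"
  unfolding A4_automorphism_def by (simp add: vec.linear_id)

lemma A4_line_generator_automorphic_to_representative:
  assumes "w \<in> A4_line_generators"
  obtains f where "A4_automorphism f"
    "f w \<in> {e1, e2, e1 - e2, e1 + e2 + \<i> *s e3, e1 - e2 + \<i> *s e3}"
proof (cases "w = e1 + e2 - \<i> *s e3 \<or> w = e1 - e2 - \<i> *s e3")
  case True
  then have "A4_negate_e3 w \<in> {e1 + e2 + \<i> *s e3, e1 - e2 + \<i> *s e3}"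
    by (auto simp: A4_eq_iff)
  then show thesis
    using that A4_automorphism_negate_e3 by blast
next
  case False
  with assms show thesis
    using that[OF A4_automorphism_id] unfolding A4_line_generators_def by auto
qed

lemma A4_one_dim_subalgebra_automorphic_to_representative:
  assumes "A4_subalgebra S \<and> vec.dim S = 1"
  obtains f where "A4_automorphism f"
    "f ` S \<in> (\<lambda>u. vec.span {u}) ` {e1, e2, e1 - e2, e1 + e2 + \<i> *s e3, e1 - e2 + \<i> *s e3}"
proof -
  obtain w where w: "w \<in> A4_line_generators" "S = vec.span {w}"
    using assms unfolding A4_one_dim_subalgebra_iff by blast
  obtain f where f: "A4_automorphism f"
    "f w \<in> {e1, e2, e1 - e2, e1 + e2 + \<i> *s e3, e1 - e2 + \<i> *s e3}"
    using A4_line_generator_automorphic_to_representative[OF w(1)] .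
  then have "f ` S = vec.span {f w}"
    using w(2) vec.linear_span_image[of f "{w}"] by (simp add: A4_automorphism_def)
  with f show thesis
    using that by blast
qed

theorem mainTheorem10:
  shows "(\<forall>S. (A4_subalgebra S \<and> vec.dim S = 1) \<longleftrightarrow>
            S \<in> {vec.span {e1}, vec.span {e2}, vec.span {e1 - e2},
                 vec.span {e1 + e2 + \<i> *s e3}, vec.span {e1 + e2 - \<i> *s e3},
                 vec.span {e1 - e2 + \<i> *s e3}, vec.span {e1 - e2 - \<i> *s e3}})
       \<and> (\<forall>S. A4_subalgebra S \<and> vec.dim S = 1 \<longrightarrow>
            (\<exists>f T. A4_automorphism f \<and> f ` S = T \<and>
               T \<in> {vec.span {e1}, vec.span {e2}, vec.span {e1 - e2},
                    vec.span {e1 + e2 + \<i> *s e3}, vec.span {e1 - e2 + \<i> *s e3}}))"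
proof -
  have lines: "{vec.span {e1}, vec.span {e2}, vec.span {e1 - e2},
      vec.span {e1 + e2 + \<i> *s e3}, vec.span {e1 + e2 - \<i> *s e3},
      vec.span {e1 - e2 + \<i> *s e3}, vec.span {e1 - e2 - \<i> *s e3}}
    = (\<lambda>w. vec.span {w}) ` A4_line_generators"
    by (simp only: A4_line_generators_def image_insert image_empty)
  have "\<exists>f T. A4_automorphism f \<and> f ` S = T \<and>
      T \<in> {vec.span {e1}, vec.span {e2}, vec.span {e1 - e2},
        vec.span {e1 + e2 + \<i> *s e3}, vec.span {e1 - e2 + \<i> *s e3}}"
    if S: "A4_subalgebra S \<and> vec.dim S = 1" for S
  proof -
    obtain f where "A4_automorphism f" "f ` S \<in> (\<lambda>u. vec.span {u}) `
        {e1, e2, e1 - e2, e1 + e2 + \<i> *s e3, e1 - e2 + \<i> *s e3}"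
      using A4_one_dim_subalgebra_automorphic_to_representative[OF S] .
    then show ?thesis
      unfolding image_insert image_empty by blast
  qed
  then show ?thesis
    unfolding lines using A4_one_dim_subalgebra_iff by (intro conjI allI impI) simp_all
qed

end
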